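(* Let $\lambda=[\lambda_1,\ldots,\lambda_k]$ be a partition, $n$ a positive integer, and $v$ a strictly increasing vector of length $k$ with entries in $\{1,\ldots,n\}$. There is an explicit bijection between $M(v,\lambda,n)$ and $SSYT(v,\lambda,n)$.
   Context: A partition is a weakly decreasing sequence of positive integers; $a_i$ is the number of parts equal to $i$. $SSYT(v,\lambda,n)$ is the set of semistandard Young tableaux of shape $\lambda$ (rows weakly increasing, columns strictly increasing) with entries at most $n$ whose first column, read top to bottom, is $v$. A sign matrix is a matrix with entries in $\{-1,0,1\}$ whose column partial sums from the top lie in $\{0,1\}$ and whose row partial sums from the left are nonnegative. $M(v,\lambda,n)$ is the set of $\lambda_1\times n$ sign matrices whose $i$-th row sums to $a_{\lambda_1-i+1}$ for all $i$ and whose $j$-th column sums to $1$ if $j$ is an entry of $v$ and $0$ otherwise. *)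

theory Defs
  imports "Jordan_Normal_Form.Matrix"
begin

definition is_int_partition :: "nat list \<Rightarrow> bool" where
  "is_int_partition lam \<longleftrightarrow> sorted_wrt (\<ge>) lam \<and> (\<forall>l\<in>set lam. 0 < l)"

(* The empty partition is allowed; its largest part is 0 by convention. *)
definition largest_part :: "nat list \<Rightarrow> nat" where
  "largest_part lam = (case lam of [] \<Rightarrow> 0 | l # _ \<Rightarrow> l)"

(* A tableau is the list of its rows, top to bottom (English notation). *)
definition semistandard :: "nat list \<Rightarrow> nat \<Rightarrow> nat list list \<Rightarrow> bool" where
  "semistandard lam n T \<longleftrightarrow>
     map length T = lam \<and>
     (\<forall>row\<in>set T. sorted row \<and> set row \<subseteq> {1..n}) \<and>
     (\<forall>r c. Suc r < length T \<and> c < length (T ! Suc r) \<longrightarrow> T ! r ! c < T ! Suc r ! c)"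

definition SSYT :: "nat list \<Rightarrow> nat list \<Rightarrow> nat \<Rightarrow> nat list list set" where
  "SSYT v lam n = {T. semistandard lam n T \<and> map hd T = v}"

definition sign_matrix :: "int mat \<Rightarrow> bool" where
  "sign_matrix A \<longleftrightarrow>
     (\<forall>i<dim_row A. \<forall>j<dim_col A. A $$ (i, j) \<in> {-1, 0, 1}) \<and>
     (\<forall>i<dim_row A. \<forall>j<dim_col A. (\<Sum>i'\<le>i. A $$ (i', j)) \<in> {0, 1}) \<and>
     (\<forall>i<dim_row A. \<forall>j<dim_col A. 0 \<le> (\<Sum>j'\<le>j. A $$ (i, j')))"

(* Matrix indices start at 0: row i is the (i+1)-st row, so its sum is the number
   of parts equal to largest_part lam - i, and column j belongs to the entry j+1. *)
definition sign_matrices :: "nat list \<Rightarrow> nat list \<Rightarrow> nat \<Rightarrow> int mat set" where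
  "sign_matrices v lam n =
     {A \<in> carrier_mat (largest_part lam) n.
        sign_matrix A \<and>
        (\<forall>i<largest_part lam.
           (\<Sum>j<n. A $$ (i, j)) = int (count_list lam (largest_part lam - i))) \<and>
        (\<forall>j<n. (\<Sum>i<largest_part lam. A $$ (i, j)) = (if Suc j \<in> set v then 1 else 0))}"

(* The entries of column c (counted from 0 at the left) of the tableau of A: the sum of
   the first dim_row A - c rows of A is the indicator vector of this set.  Thus adding
   the rows of A from the top builds the columns of the tableau from right to left. *)
definition column_entries :: "int mat \<Rightarrow> nat \<Rightarrow> nat set" where
  "column_entries A c =
     {Suc j | j. j < dim_col A \<and> (\<Sum>i<dim_row A - c. A $$ (i, j)) = 1}"

definition tableau_of_sign_matrix :: "nat list \<Rightarrow> int mat \<Rightarrow> nat list list" where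
  "tableau_of_sign_matrix lam A =
     map (\<lambda>r. map (\<lambda>c. sorted_list_of_set (column_entries A c) ! r) [0..<lam ! r])
         [0..<length lam]"

end

theory Submission
  imports Defs
begin

text \<open>
  Both sides are encoded by the sequence of sets formed by the entries of the columns of a
  tableau. Adding the rows of a sign matrix from the top produces the indicator vectors of these
  sets, from the last column to the first, so the rows of the matrix are the differences of
  consecutive indicator vectors. The row partial sums are nonnegative iff the rank function of
  each column set dominates that of the next one, and this says precisely that the sorted
  columns form weakly increasing rows.
\<close>

section \<open>Rank functions and sorted enumerations of finite sets\<close>

text \<open>In the increasing enumeration the elements at most \<open>x\<close> form an initial
  segment, so position \<open>r\<close> lies in it iff \<open>r\<close> is less than its
  length.\<close>

lemma nth_sorted_list_of_set_le_iff:
  fixes S :: "'a::linorder set"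
  assumes "finite S" "r < card S"
  shows "sorted_list_of_set S ! r \<le> x \<longleftrightarrow> r < card {y \<in> S. y \<le> x}"
proof -
  define xs where "xs = sorted_list_of_set S"
  have len: "length xs = card S" and S: "set xs = S" and srt: "sorted xs" and dist: "distinct xs"
    using assms by (auto simp: xs_def)
  have "{y \<in> S. y \<le> x} = (!) xs ` {i. i < length xs \<and> xs ! i \<le> x}"
    by (auto simp: S[symmetric] set_conv_nth)
  moreover have "inj_on ((!) xs) {i. i < length xs \<and> xs ! i \<le> x}"
    using dist by (auto simp: inj_on_def nth_eq_iff_index_eq)
  ultimately have card: "card {y \<in> S. y \<le> x} = card {i. i < length xs \<and> xs ! i \<le> x}"
    by (simp add: card_image)
  show ?thesis
  proof (cases "xs ! r \<le> x")
    case True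
    have "{..r} \<subseteq> {i. i < length xs \<and> xs ! i \<le> x}"
      using True assms(2) len sorted_nth_mono[OF srt] by (fastforce intro: order_trans)
    then have "card {..r} \<le> card {i. i < length xs \<and> xs ! i \<le> x}"
      by (intro card_mono) auto
    with True show ?thesis by (simp add: card xs_def)
  next
    case False
    have "{i. i < length xs \<and> xs ! i \<le> x} \<subseteq> {..<r}"
    proof
      fix i assume i: "i \<in> {i. i < length xs \<and> xs ! i \<le> x}"
      show "i \<in> {..<r}"
      proof (rule ccontr)
        assume "i \<notin> {..<r}"
        then have "xs ! r \<le> xs ! i" using i by (intro sorted_nth_mono[OF srt]) auto
        then show False using i False by auto
      qed
    qed
    then have "card {i. i < length xs \<and> xs ! i \<le> x} \<le> card {..<r}"
      by (intro card_mono) auto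
    with False show ?thesis by (simp add: card xs_def)
  qed
qed

text \<open>This turns an inequality of rank functions into an entrywise one. Forwards, take for
  \<open>x\<close> the \<open>r\<close>-th element of \<open>T\<close>; backwards, at a violating
  \<open>x\<close>, take for \<open>r\<close> the rank of \<open>x\<close> in \<open>S\<close>. The
  bound on the cardinalities keeps \<open>r\<close> a valid index of both enumerations.\<close>

lemma rank_dominance_iff:
  fixes S T :: "'a::linorder set"
  assumes "finite S" "finite T" "card T \<le> card S"
  shows "(\<forall>x. card {y \<in> T. y \<le> x} \<le> card {y \<in> S. y \<le> x}) \<longleftrightarrow>
         (\<forall>r<card T. sorted_list_of_set S ! r \<le> sorted_list_of_set T ! r)"
    (is "?L \<longleftrightarrow> ?R")
proof
  assume L: ?L
  show ?R
  proof (intro allI impI)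
    fix r assume r: "r < card T"
    have "r < card {y \<in> T. y \<le> sorted_list_of_set T ! r}"
      using nth_sorted_list_of_set_le_iff[OF assms(2) r] by blast
    also have "\<dots> \<le> card {y \<in> S. y \<le> sorted_list_of_set T ! r}"
      using L by blast
    finally show "sorted_list_of_set S ! r \<le> sorted_list_of_set T ! r"
      using nth_sorted_list_of_set_le_iff[OF assms(1)] r assms(3) by fastforce
  qed
next
  assume R: ?R
  show ?L
  proof (rule allI, rule ccontr)
    fix x
    define r where "r = card {y \<in> S. y \<le> x}"
    assume "\<not> card {y \<in> T. y \<le> x} \<le> card {y \<in> S. y \<le> x}"
    then have lt: "r < card {y \<in> T. y \<le> x}" by (simp add: r_def)
    have "card {y \<in> T. y \<le> x} \<le> card T"
      using assms(2) by (intro card_mono) auto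
    then have r: "r < card T" using lt by simp
    have "sorted_list_of_set T ! r \<le> x"
      using nth_sorted_list_of_set_le_iff[OF assms(2) r] lt by blast
    then have "sorted_list_of_set S ! r \<le> x"
      using R r by (blast intro: order_trans)
    then have "r < card {y \<in> S. y \<le> x}"
      using nth_sorted_list_of_set_le_iff[OF assms(1)] r assms(3) by fastforce
    then show False by (simp add: r_def)
  qed
qed

lemma sorted_list_of_set_image_upt:
  fixes f :: "nat \<Rightarrow> 'a::linorder"
  assumes "\<And>i. Suc i < m \<Longrightarrow> f i < f (Suc i)"
  shows "sorted_list_of_set (f ` {..<m}) = map f [0..<m]"
    and "card (f ` {..<m}) = m"
proof -
  have s: "sorted_wrt (<) (map f [0..<m])"
    using assms by (subst sorted_wrt_iff_nth_Suc_transp) auto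
  then have "distinct (map f [0..<m])" "sorted (map f [0..<m])"
    using strict_sorted_iff by blast+
  moreover have img: "set (map f [0..<m]) = f ` {..<m}"
    by (auto simp: image_iff)
  ultimately show "sorted_list_of_set (f ` {..<m}) = map f [0..<m]"
    using sorted_list_of_set.idem_if_sorted_distinct[of "map f [0..<m]"] by simp
  show "card (f ` {..<m}) = m"
    using distinct_card[OF \<open>distinct (map f [0..<m])\<close>] img by simp
qed

text \<open>Links row partial sums to rank functions. Position \<open>j\<close> stands for the entry
  \<open>Suc j\<close>, so an element \<open>0\<close> of \<open>S\<close> would be counted on the
  right only.\<close>

lemma sum_of_bool_Suc_mem:
  assumes "0 \<notin> S"
  shows "(\<Sum>j<m. of_bool (Suc j \<in> S)) = int (card {x \<in> S. x \<le> m})"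
proof -
  have "(\<Sum>j<m. of_bool (Suc j \<in> S) :: int) = int (card {j. j < m \<and> Suc j \<in> S})"
    by (simp add: of_bool_def sum.If_cases lessThan_def Int_def)
  also have "{x \<in> S. x \<le> m} = Suc ` {j. j < m \<and> Suc j \<in> S}"
  proof (rule Set.set_eqI)
    fix x show "x \<in> {x \<in> S. x \<le> m} \<longleftrightarrow> x \<in> Suc ` {j. j < m \<and> Suc j \<in> S}"
      using assms by (cases x) auto
  qed
  then have "card {j. j < m \<and> Suc j \<in> S} = card {x \<in> S. x \<le> m}"
    by (simp add: card_image)
  finally show ?thesis .
qed

section \<open>Column lengths of the Young diagram\<close>

text \<open>For a partition this is the part with index \<open>c\<close>, counted from 0, of the
  conjugate partition.\<close>

definition column_height :: "nat list \<Rightarrow> nat \<Rightarrow> nat" where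
  "column_height lam c = length (filter ((<) c) lam)"

lemma column_height_0: "is_int_partition lam \<Longrightarrow> column_height lam 0 = length lam"
  by (simp add: column_height_def is_int_partition_def)

text \<open>Ties heights to row sums: the row of the matrix that leads from column
  \<open>Suc c\<close> to column \<open>c\<close> has to sum to the last term.\<close>

lemma column_height_Suc:
  "column_height lam c = column_height lam (Suc c) + count_list lam (Suc c)"
  unfolding column_height_def by (induction lam) auto

lemma le_largest_part: "is_int_partition lam \<Longrightarrow> l \<in> set lam \<Longrightarrow> l \<le> largest_part lam"
  by (auto simp: is_int_partition_def largest_part_def split: list.splits)

lemma column_height_eq_0:
  assumes "is_int_partition lam" "largest_part lam \<le> c"
  shows "column_height lam c = 0"
  using le_largest_part[OF assms(1)] assms(2)
  by (force simp: column_height_def filter_empty_conv)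

text \<open>Induction downwards from the largest part: each lowering of \<open>c\<close> by one
  appends one summand, which is the increment in \<open>column_height_Suc\<close>. Beyond the
  largest part truncated subtraction makes the sum empty.\<close>

lemma sum_count_list_eq_column_height:
  assumes "is_int_partition lam"
  shows "(\<Sum>i<largest_part lam - c. count_list lam (largest_part lam - i)) = column_height lam c"
proof (cases "c \<le> largest_part lam")
  case True
  then show ?thesis
  proof (induction c rule: inc_induct)
    case base
    then show ?case using column_height_eq_0[OF assms] by simp
  next
    case (step c)
    then have "largest_part lam - c = Suc (largest_part lam - Suc c)" by simp
    then show ?case
      using step column_height_Suc[of lam c] by simp
  qed
qed (simp add: column_height_eq_0[OF assms])

text \<open>Since the parts decrease weakly, the rows reaching column \<open>c\<close> are the
  topmost ones, so membership of a cell in the diagram can be tested by row or by column.\<close>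

lemma less_column_height_iff:
  assumes "is_int_partition lam" "r < length lam"
  shows "r < column_height lam c \<longleftrightarrow> c < lam ! r"
proof -
  have "sorted_wrt (\<ge>) lam" using assms by (simp add: is_int_partition_def)
  then show ?thesis using assms(2)
  proof (induction lam arbitrary: r)
    case (Cons l lam)
    have "column_height lam c = 0" if "l \<le> c"
      using Cons.prems that by (force simp: column_height_def filter_empty_conv)
    then show ?case
      using Cons by (cases r) (force simp: column_height_def)+
  qed simp
qed

lemma column_height_le_length: "column_height lam c \<le> length lam"
  by (simp add: column_height_def)

section \<open>Column chains and sign matrices\<close>

text \<open>The object between the two sides: \<open>S c\<close> is the entry set of column
  \<open>c\<close>. Neighbouring columns are compared by ranks because row partial sums are
  differences of ranks. Past the last column the height 0 forces the empty set, so a chain is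
  determined as a function on all of \<open>nat\<close>.\<close>

definition column_chains :: "nat list \<Rightarrow> nat list \<Rightarrow> nat \<Rightarrow> (nat \<Rightarrow> nat set) set" where
  "column_chains v lam n =
     {S. S 0 = set v \<and>
         (\<forall>c. S c \<subseteq> {1..n} \<and> card (S c) = column_height lam c \<and>
              (\<forall>x. card {y \<in> S (Suc c). y \<le> x} \<le> card {y \<in> S c. y \<le> x}))}"

text \<open>Row \<open>i\<close> holds the change from the column set at \<open>m - i\<close> to its
  left neighbour; for a chain with largest part \<open>m\<close> this starts from the empty
  set.\<close>

definition matrix_of_columns :: "nat \<Rightarrow> nat \<Rightarrow> (nat \<Rightarrow> nat set) \<Rightarrow> int mat" where
  "matrix_of_columns m n S =
     mat m n (\<lambda>(i, j). of_bool (Suc j \<in> S (m - Suc i)) - of_bool (Suc j \<in> S (m - i)))"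

text \<open>The sum telescopes, and \<open>S m = {}\<close> removes the term left over at the
  top.\<close>

lemma sum_rows_matrix_of_columns:
  assumes "k \<le> m" "j < n" "S m = {}"
  shows "(\<Sum>i<k. matrix_of_columns m n S $$ (i, j)) = of_bool (Suc j \<in> S (m - k))"
  using assms(1)
proof (induction k)
  case 0
  then show ?case using assms by simp
next
  case (Suc k)
  then show ?case using assms(2) by (simp add: matrix_of_columns_def)
qed

lemma column_entries_matrix_of_columns:
  assumes "\<And>c. S c \<subseteq> {1..n}" "\<And>c. m \<le> c \<Longrightarrow> S c = {}"
  shows "column_entries (matrix_of_columns m n S) = S"
proof
  fix c
  have dims: "dim_row (matrix_of_columns m n S) = m" "dim_col (matrix_of_columns m n S) = n"
    by (auto simp: matrix_of_columns_def)
  have "(\<Sum>i<m - c. matrix_of_columns m n S $$ (i, j)) = of_bool (Suc j \<in> S c)"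
    if "j < n" for j
  proof (cases "c \<le> m")
    case True
    then show ?thesis using that assms(2) by (simp add: sum_rows_matrix_of_columns)
  next
    \<comment> \<open>Here \<open>m - c\<close> is 0, so the sum is empty, and so is
      \<open>S c\<close>.\<close>
    case False
    then show ?thesis using assms(2)[of c] by simp
  qed
  then have "column_entries (matrix_of_columns m n S) c = {Suc j |j. j < n \<and> Suc j \<in> S c}"
    by (auto simp: column_entries_def dims)
  also have "\<dots> = S c"
  proof (rule Set.set_eqI)
    fix x show "x \<in> {Suc j |j. j < n \<and> Suc j \<in> S c} \<longleftrightarrow> x \<in> S c"
      using assms(1)[of c] by (cases x) auto
  qed
  finally show "column_entries (matrix_of_columns m n S) c = S c" .
qed

lemma column_chains_empty:
  assumes "is_int_partition lam" "S \<in> column_chains v lam n" "largest_part lam \<le> c"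
  shows "S c = {}"
proof -
  have "S c \<subseteq> {1..n}" "card (S c) = 0"
    using assms column_height_eq_0 by (auto simp: column_chains_def)
  then show ?thesis using finite_subset by fastforce
qed

text \<open>Telescoping makes the column partial sums indicator values, ending with those of
  \<open>S 0\<close>. Row partial sums are differences of ranks, nonnegative by the chain condition;
  at full width they become differences of heights, which are multiplicities of parts.\<close>

lemma matrix_of_columns_in_sign_matrices:
  assumes lam: "is_int_partition lam" and S: "S \<in> column_chains v lam n"
  shows "matrix_of_columns (largest_part lam) n S \<in> sign_matrices v lam n"
proof -
  define m where "m = largest_part lam"
  define A where "A = matrix_of_columns m n S"
  have sub: "S c \<subseteq> {1..n}" and card: "card (S c) = column_height lam c"
    and dom: "card {y \<in> S (Suc c). y \<le> x} \<le> card {y \<in> S c. y \<le> x}" and S0: "S 0 = set v"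
    for c x
    using S by (auto simp: column_chains_def)
  have dims: "dim_row A = m" "dim_col A = n"
    by (auto simp: A_def matrix_of_columns_def)
  have empty: "S m = {}"
    using column_chains_empty[OF lam S] by (simp add: m_def)
  have cols: "(\<Sum>i<k. A $$ (i, j)) = of_bool (Suc j \<in> S (m - k))" if "k \<le> m" "j < n" for k j
    using sum_rows_matrix_of_columns[OF that, of S] empty by (simp add: A_def)
  have rows: "(\<Sum>j<k. A $$ (i, j)) =
      int (card {y \<in> S (m - Suc i). y \<le> k}) - int (card {y \<in> S (m - i). y \<le> k})"
    if "i < m" "k \<le> n" for i k
  proof -
    have "(\<Sum>j<k. A $$ (i, j)) =
        (\<Sum>j<k. of_bool (Suc j \<in> S (m - Suc i)) - of_bool (Suc j \<in> S (m - i)))"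
      using that by (intro sum.cong) (auto simp: A_def matrix_of_columns_def)
    moreover have "0 \<notin> S c" for c using sub[of c] by auto
    ultimately show ?thesis by (simp only: sum_subtractf sum_of_bool_Suc_mem not_False_eq_True)
  qed
  have full: "{y \<in> S c. y \<le> n} = S c" for c using sub[of c] by auto
  have "A $$ (i, j) \<in> {-1, 0, 1}" if "i < m" "j < n" for i j
    using that by (auto simp: A_def matrix_of_columns_def)
  moreover have "(\<Sum>i'\<le>i. A $$ (i', j)) \<in> {0, 1}" if "i < m" "j < n" for i j
    using cols[of "Suc i" j] that by (simp add: lessThan_Suc_atMost)
  \<comment> \<open>Dominance applies because \<open>m - i\<close> is the successor of
    \<open>m - Suc i\<close> when \<open>i < m\<close>.\<close>
  moreover have "0 \<le> (\<Sum>j'\<le>j. A $$ (i, j'))" if "i < m" "j < n" for i j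
    using rows[of i "Suc j"] dom[of "m - Suc i" "Suc j"] that
    by (simp add: lessThan_Suc_atMost Suc_diff_Suc)
  moreover have "(\<Sum>j<n. A $$ (i, j)) = int (count_list lam (m - i))" if "i < m" for i
    using rows[of i n] column_height_Suc[of lam "m - Suc i"] that
    by (simp add: full card Suc_diff_Suc)
  moreover have "(\<Sum>i<m. A $$ (i, j)) = (if Suc j \<in> set v then 1 else 0)" if "j < n" for j
    using cols[of m j] that S0 by simp
  ultimately show ?thesis
    unfolding sign_matrices_def sign_matrix_def m_def[symmetric] A_def[symmetric]
    using dims by auto
qed

text \<open>As column partial sums are 0 or 1, the sets in \<open>column_entries\<close> record them
  completely, and thereby every entry of \<open>A\<close>.\<close>

lemma column_entries_in_column_chains:
  assumes lam: "is_int_partition lam" and v: "set v \<subseteq> {1..n}" and A: "A \<in> sign_matrices v lam n"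
  shows "column_entries A \<in> column_chains v lam n"
    and "matrix_of_columns (largest_part lam) n (column_entries A) = A"
proof -
  define m where "m = largest_part lam"
  define S where "S = column_entries A"
  have dims: "dim_row A = m" "dim_col A = n"
    using A by (auto simp: sign_matrices_def m_def)
  have "sign_matrix A" using A by (simp add: sign_matrices_def)
  have part: "(\<Sum>i'\<le>i. A $$ (i', j)) \<in> {0, 1}" "0 \<le> (\<Sum>j'\<le>j. A $$ (i, j'))"
    if "i < m" "j < n" for i j
    using \<open>sign_matrix A\<close> that unfolding sign_matrix_def dims by blast+
  have row: "(\<Sum>j<n. A $$ (i, j)) = int (count_list lam (m - i))" if "i < m" for i
    using A that by (auto simp: sign_matrices_def m_def)
  have col: "(\<Sum>i<m. A $$ (i, j)) = (if Suc j \<in> set v then 1 else 0)" if "j < n" for j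
    using A that by (auto simp: sign_matrices_def m_def)
  have S: "S c = {Suc j | j. j < n \<and> (\<Sum>i<m - c. A $$ (i, j)) = 1}" for c
    by (simp add: S_def column_entries_def dims)
  have sub: "S c \<subseteq> {1..n}" for c by (auto simp: S)
  \<comment> \<open>The sign condition covers nonempty partial sums only; for
    \<open>m - c = 0\<close> the sum is 0 and \<open>S c\<close> is empty.\<close>
  have cols: "(\<Sum>i<m - c. A $$ (i, j)) = of_bool (Suc j \<in> S c)" if "j < n" for c j
  proof (cases "m - c")
    case (Suc i)
    then show ?thesis
      using part(1)[of i j] that by (auto simp: S lessThan_Suc_atMost)
  qed (simp add: S)
  \<comment> \<open>An entry in row \<open>i\<close> is the difference of the partial sums over
    \<open>Suc i\<close> and \<open>i\<close> rows.\<close>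
  have entry: "A $$ (i, j) = of_bool (Suc j \<in> S (m - Suc i)) - of_bool (Suc j \<in> S (m - i))"
    if "i < m" "j < n" for i j
    using cols[of j "m - Suc i"] cols[of j "m - i"] that by simp
  show "matrix_of_columns (largest_part lam) n (column_entries A) = A"
    using dims entry by (intro eq_matI) (auto simp: matrix_of_columns_def m_def S_def)
  have no0: "0 \<notin> S c" for c using sub[of c] by auto
  have card: "card (S c) = column_height lam c" for c
  proof -
    have "{x \<in> S c. x \<le> n} = S c" using sub[of c] by auto
    \<comment> \<open>Count the ones of the indicator vector, then exchange the summations so that
      the prescribed sums of the first \<open>m - c\<close> rows appear.\<close>
    then have "int (card (S c)) = (\<Sum>j<n. of_bool (Suc j \<in> S c))"
      by (simp only: sum_of_bool_Suc_mem[OF no0])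
    also have "\<dots> = (\<Sum>j<n. \<Sum>i<m - c. A $$ (i, j))"
      by (intro sum.cong) (auto simp: cols)
    also have "\<dots> = (\<Sum>i<m - c. \<Sum>j<n. A $$ (i, j))" by (rule sum.swap)
    also have "\<dots> = int (\<Sum>i<m - c. count_list lam (m - i))" by (simp add: row)
    also have "\<dots> = int (column_height lam c)"
      using sum_count_list_eq_column_height[OF lam] by (simp add: m_def)
    finally show ?thesis by simp
  qed
  \<comment> \<open>Row partial sums speak only of thresholds from 1 to \<open>n\<close>. As all
    sets lie in \<open>{1..n}\<close>, \<open>x\<close> may be replaced by \<open>min x n\<close>;
    at threshold 0, and for \<open>c\<close> at least \<open>m\<close>, the left-hand set is
    empty.\<close>
  have dom: "card {y \<in> S (Suc c). y \<le> x} \<le> card {y \<in> S c. y \<le> x}" for c x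
  proof (cases "c < m \<and> 0 < min x n")
    case True
    then obtain j where j: "min x n = Suc j" "j < n" by (cases "min x n") auto
    \<comment> \<open>The row whose addition turns column \<open>Suc c\<close> into column
      \<open>c\<close>.\<close>
    define i where "i = m - Suc c"
    have i: "i < m" "m - Suc i = c" "m - i = Suc c" using True by (auto simp: i_def)
    have "{y \<in> S c. y \<le> x} = {y \<in> S c. y \<le> Suc j}" for c
      using sub[of c] j(1)[symmetric] by auto
    moreover have "0 \<le> (\<Sum>j'<Suc j. of_bool (Suc j' \<in> S c) - of_bool (Suc j' \<in> S (Suc c)) :: int)"
    proof -
      have "(\<Sum>j'\<le>j. A $$ (i, j')) =
          (\<Sum>j'<Suc j. of_bool (Suc j' \<in> S c) - of_bool (Suc j' \<in> S (Suc c)))"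
        unfolding lessThan_Suc_atMost using i j(2) by (intro sum.cong) (auto simp: entry)
      then show ?thesis using part(2)[OF i(1) j(2)] by simp
    qed
    ultimately show ?thesis
      unfolding sum_subtractf sum_of_bool_Suc_mem[OF no0] by simp
  next
    case False
    then have "\<not> c < m \<or> \<not> 0 < min x n" by simp
    then have "{y \<in> S (Suc c). y \<le> x} = {}"
    proof
      assume "\<not> c < m" then show ?thesis by (auto simp: S)
    next
      assume "\<not> 0 < min x n" then show ?thesis using sub[of "Suc c"] by auto
    qed
    then show ?thesis by (simp only: card.empty)
  qed
  \<comment> \<open>Column sums only see positions below \<open>n\<close>; this suffices since
    \<open>set v\<close> lies in \<open>{1..n}\<close>.\<close>
  have "S 0 = set v"
  proof (rule Set.set_eqI)
    fix x show "x \<in> S 0 \<longleftrightarrow> x \<in> set v"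
      using v by (cases x) (auto simp: S col split: if_splits)
  qed
  then show "column_entries A \<in> column_chains v lam n"
    using sub card dom by (auto simp: column_chains_def S_def)
qed

lemma bij_betw_column_entries:
  assumes "is_int_partition lam" "set v \<subseteq> {1..n}"
  shows "bij_betw column_entries (sign_matrices v lam n) (column_chains v lam n)"
proof (rule bij_betw_byWitness[where f' = "matrix_of_columns (largest_part lam) n"])
  show "\<forall>S\<in>column_chains v lam n. column_entries (matrix_of_columns (largest_part lam) n S) = S"
  proof
    fix S assume S: "S \<in> column_chains v lam n"
    then have "S c \<subseteq> {1..n}" for c by (simp add: column_chains_def)
    with column_chains_empty[OF assms(1) S]
    show "column_entries (matrix_of_columns (largest_part lam) n S) = S"
      by (metis column_entries_matrix_of_columns)
  qed
qed (use column_entries_in_column_chains[OF assms] matrix_of_columns_in_sign_matrices[OF assms(1)]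
      in auto)

section \<open>Column chains and tableaux\<close>

text \<open>The second half of \<open>tableau_of_sign_matrix\<close>, with arbitrary sets in place
  of those read off a matrix.\<close>

definition tableau_of_columns :: "nat list \<Rightarrow> (nat \<Rightarrow> nat set) \<Rightarrow> nat list list" where
  "tableau_of_columns lam S =
     map (\<lambda>r. map (\<lambda>c. sorted_list_of_set (S c) ! r) [0..<lam ! r]) [0..<length lam]"

text \<open>For a tableau of shape \<open>lam\<close>, exactly the rows with index below the column
  height reach column \<open>c\<close>; stopping there avoids unspecified values of
  \<open>!\<close>.\<close>

definition tableau_column :: "nat list \<Rightarrow> nat list list \<Rightarrow> nat \<Rightarrow> nat set" where
  "tableau_column lam T c = (\<lambda>r. T ! r ! c) ` {..<column_height lam c}"

text \<open>Columns increase strictly as enumerations of sets, rows weakly by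
  \<open>rank_dominance_iff\<close>; the first column is \<open>v\<close> because a strictly
  increasing list enumerates its own set. The enumeration of \<open>S c\<close> is exactly as long
  as column \<open>c\<close>, so the cells of that column exhaust \<open>S c\<close>.\<close>

lemma tableau_of_columns_in_SSYT:
  assumes lam: "is_int_partition lam" and v: "length v = length lam" "sorted_wrt (<) v"
    and S: "S \<in> column_chains v lam n"
  shows "tableau_of_columns lam S \<in> SSYT v lam n"
    and "tableau_column lam (tableau_of_columns lam S) = S"
proof -
  define T where "T = tableau_of_columns lam S"
  have sub: "S c \<subseteq> {1..n}" and card: "card (S c) = column_height lam c"
    and dom: "card {y \<in> S (Suc c). y \<le> x} \<le> card {y \<in> S c. y \<le> x}" and S0: "S 0 = set v"
    for c x
    using S by (auto simp: column_chains_def)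
  have fin: "finite (S c)" for c using sub[of c] finite_subset by blast
  have len: "map length T = lam" "length T = length lam"
    by (auto simp: T_def tableau_of_columns_def intro: nth_equalityI)
  have row_len: "length (T ! r) = lam ! r" if "r < length lam" for r
    using that by (simp add: T_def tableau_of_columns_def)
  have nth: "T ! r ! c = sorted_list_of_set (S c) ! r" if "r < length lam" "c < lam ! r" for r c
    using that by (simp add: T_def tableau_of_columns_def)
  \<comment> \<open>For \<open>r\<close> past the last row \<open>lam ! r\<close> is unspecified,
    but both sides are false, as heights are at most \<open>length lam\<close>.\<close>
  have h: "r < column_height lam c \<longleftrightarrow> r < length lam \<and> c < lam ! r" for r c
    using less_column_height_iff[OF lam, of r c] column_height_le_length[of lam c] by force
  have mem: "sorted_list_of_set (S c) ! r \<in> S c" if "r < column_height lam c" for r c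
    using that nth_mem[of r "sorted_list_of_set (S c)"] fin card by simp
  have rows: "sorted (T ! r) \<and> set (T ! r) \<subseteq> {1..n}" if r: "r < length lam" for r
  proof
    show "sorted (T ! r)"
    proof (subst sorted_iff_nth_Suc, intro allI impI)
      fix c assume "Suc c < length (T ! r)"
      then have c: "Suc c < lam ! r" using row_len r by simp
      then have r': "r < card (S (Suc c))" using h r card by simp
      have "card (S (Suc c)) \<le> card (S c)"
        using column_height_Suc[of lam c] by (simp add: card)
      then show "T ! r ! c \<le> T ! r ! Suc c"
        using rank_dominance_iff[OF fin fin, of "Suc c" c] dom[of c] r' c r by (simp add: nth)
    qed
    show "set (T ! r) \<subseteq> {1..n}"
    proof
      fix x assume "x \<in> set (T ! r)"
      then obtain c where "c < lam ! r" "x = T ! r ! c"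
        using row_len[OF r] by (auto simp: in_set_conv_nth)
      then show "x \<in> {1..n}" using mem[of r c] sub[of c] h r nth by auto
    qed
  qed
  have cols: "T ! r ! c < T ! Suc r ! c" if "Suc r < length T" "c < length (T ! Suc r)" for r c
  proof -
    have *: "Suc r < length lam" "c < lam ! Suc r" using that len row_len by auto
    then have "Suc r < column_height lam c" using h by blast
    moreover from this have "r < length lam" "c < lam ! r" using h[of r c] by auto
    ultimately show ?thesis
      using * sorted_wrt_nth_less[OF strict_sorted_list_of_set[of "S c"], of r "Suc r"]
      by (simp add: nth card)
  qed
  have "map hd T = v"
  proof (rule nth_equalityI)
    show "length (map hd T) = length v" using len v by simp
    fix r assume "r < length (map hd T)"
    then have r: "r < length lam" using len by simp
    \<comment> \<open>Parts are positive, so no row is empty and \<open>hd\<close> is the entry at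
      index 0.\<close>
    then have r0: "0 < lam ! r" using lam by (simp add: is_int_partition_def)
    then have "hd (T ! r) = T ! r ! 0" using row_len[OF r] by (intro hd_conv_nth) auto
    also have "\<dots> = sorted_list_of_set (set v) ! r" using nth[OF r r0] S0 by simp
    also have "sorted_list_of_set (set v) = v"
      using v(2) strict_sorted_iff sorted_list_of_set.idem_if_sorted_distinct by blast
    finally show "map hd T ! r = v ! r" using r len by simp
  qed
  moreover have "\<forall>row\<in>set T. sorted row \<and> set row \<subseteq> {1..n}"
    using rows len(2) by (metis in_set_conv_nth)
  ultimately show "tableau_of_columns lam S \<in> SSYT v lam n"
    using len cols by (simp add: SSYT_def semistandard_def T_def[symmetric])
  show "tableau_column lam (tableau_of_columns lam S) = S"
  proof
    fix c
    have "tableau_column lam T c = (\<lambda>r. sorted_list_of_set (S c) ! r) ` {..<card (S c)}"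
      unfolding tableau_column_def card by (intro image_cong) (auto simp: h nth)
    also have "\<dots> = set (sorted_list_of_set (S c))"
      by (auto simp: set_conv_nth)
    finally show "tableau_column lam (tableau_of_columns lam S) c = S c"
      using fin by (simp add: T_def)
  qed
qed

text \<open>Strict increase down a column means that its entry set loses nothing: its cardinality is
  the full height and its enumeration is the column itself. Weakly increasing rows then give rank
  dominance, and rebuilding from the sets returns \<open>T\<close>.\<close>

lemma tableau_column_in_column_chains:
  assumes lam: "is_int_partition lam" and T: "T \<in> SSYT v lam n"
  shows "tableau_column lam T \<in> column_chains v lam n"
    and "tableau_of_columns lam (tableau_column lam T) = T"
proof -
  define S where "S = tableau_column lam T"
  have len: "map length T = lam" and rows: "\<And>row. row \<in> set T \<Longrightarrow> sorted row \<and> set row \<subseteq> {1..n}"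
    and cols: "\<And>r c. Suc r < length T \<Longrightarrow> c < length (T ! Suc r) \<Longrightarrow> T ! r ! c < T ! Suc r ! c"
    and hd: "map hd T = v"
    using T by (auto simp: SSYT_def semistandard_def)
  have lenT: "length T = length lam" using len by auto
  have row_len: "length (T ! r) = lam ! r" if "r < length lam" for r
    using that lenT nth_map[of r T length] unfolding len by simp
  have h: "r < column_height lam c \<longleftrightarrow> r < length lam \<and> c < lam ! r" for r c
    using less_column_height_iff[OF lam, of r c] column_height_le_length[of lam c] by force
  have step: "T ! r ! c < T ! Suc r ! c" if "Suc r < column_height lam c" for r c
    using that cols[of r c] h[of "Suc r" c] lenT row_len by simp
  have sl: "sorted_list_of_set (S c) = map (\<lambda>r. T ! r ! c) [0..<column_height lam c]"
    and card: "card (S c) = column_height lam c" for c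
    unfolding S_def tableau_column_def using step by (intro sorted_list_of_set_image_upt; blast)+
  have fin: "finite (S c)" for c by (simp add: S_def tableau_column_def)
  have sub: "S c \<subseteq> {1..n}" for c
  proof
    fix x assume "x \<in> S c"
    then obtain r where r: "r < column_height lam c" "x = T ! r ! c"
      by (auto simp: S_def tableau_column_def)
    then have "T ! r \<in> set T" "x \<in> set (T ! r)" using h[of r c] lenT row_len by auto
    then show "x \<in> {1..n}" using rows by blast
  qed
  have dom: "card {y \<in> S (Suc c). y \<le> x} \<le> card {y \<in> S c. y \<le> x}" for c x
  proof -
    have le: "card (S (Suc c)) \<le> card (S c)"
      using column_height_Suc[of lam c] by (simp add: card)
    have "sorted_list_of_set (S c) ! r \<le> sorted_list_of_set (S (Suc c)) ! r"
      if r: "r < card (S (Suc c))" for r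
    proof -
      \<comment> \<open>Row \<open>r\<close> has a cell in column \<open>Suc c\<close>, hence also
        in column \<open>c\<close>, and its sortedness compares the two.\<close>
      have "r < length lam" "Suc c < lam ! r" using r h card by auto
      then have "T ! r ! c \<le> T ! r ! Suc c"
        using rows[of "T ! r"] lenT row_len by (intro sorted_nth_mono) auto
      then show ?thesis using r le by (simp add: sl card)
    qed
    then show ?thesis using rank_dominance_iff[OF fin fin le] by blast
  qed
  have "S 0 = (\<lambda>r. T ! r ! 0) ` {..<length T}"
    by (simp add: S_def tableau_column_def column_height_0[OF lam] lenT)
  also have "\<dots> = (\<lambda>r. hd (T ! r)) ` {..<length T}"
  proof (intro image_cong refl)
    fix r assume "r \<in> {..<length T}"
    then have r: "r < length lam" using lenT by simp
    then have "0 < lam ! r" using lam by (simp add: is_int_partition_def)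
    then show "T ! r ! 0 = hd (T ! r)" using row_len[OF r] by (subst hd_conv_nth) auto
  qed
  also have "\<dots> = set v" unfolding hd[symmetric] by (force simp: set_conv_nth)
  finally have S0: "S 0 = set v" .
  show "tableau_column lam T \<in> column_chains v lam n"
    using S0 sub card dom by (auto simp: column_chains_def S_def)
  show "tableau_of_columns lam (tableau_column lam T) = T"
    unfolding S_def[symmetric] tableau_of_columns_def
    using lenT row_len h by (intro nth_equalityI) (auto simp: sl)
qed

lemma bij_betw_tableau_of_columns:
  assumes "is_int_partition lam" "length v = length lam" "sorted_wrt (<) v"
  shows "bij_betw (tableau_of_columns lam) (column_chains v lam n) (SSYT v lam n)"
  by (rule bij_betw_byWitness[where f' = "tableau_column lam"])
    (use tableau_of_columns_in_SSYT[OF assms] tableau_column_in_column_chains[OF assms(1)] in auto)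

theorem theorem9p4:
  fixes lam v :: "nat list" and n :: nat
  assumes "is_int_partition lam"
    and "0 < n"
    and "length v = length lam"
    and "sorted_wrt (<) v"
    and "set v \<subseteq> {1..n}"
  shows "bij_betw (tableau_of_sign_matrix lam) (sign_matrices v lam n) (SSYT v lam n)"
proof -
  \<comment> \<open>The map factors through the column chains, and each factor is a
    bijection.\<close>
  have "tableau_of_sign_matrix lam = tableau_of_columns lam \<circ> column_entries"
    by (auto simp: tableau_of_sign_matrix_def tableau_of_columns_def)
  then show ?thesis
    using bij_betw_trans[OF bij_betw_column_entries bij_betw_tableau_of_columns] assms by simp
qed

end
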